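(* Let $A \in \mathbb{C}^{n \times n}$ be a Hermitian matrix having at least $m$ eigenvalues (counted with multiplicity) in the interval $[-1,1]$, let $B \in \mathbb{C}^{n \times k}$, and suppose $m > 2k$. Let $q > 0$ and set $t_{\mathrm{quad}} := (\lceil m/k \rceil - 2)^2 / q$. Then for every integer $t \geq 0$ with $t \leq t_{\mathrm{quad}}$, \[ \lambda_{\min}\big(W(t)\big) \leq 4\, \frac{(\lceil m/k \rceil - 2)^2}{q}\, e^{-q}\, \|B\|_F^2. \]
   Context: For $A \in \mathbb{C}^{n\times n}$, $B \in \mathbb{C}^{n \times k}$ and an integer $t \ge 0$, the controllability Gramian is $W(t) := \sum_{i=0}^{t} A^i B B^* (A^* )^i$, where $^*$ denotes conjugate transpose; $\lambda_{\min}$ denotes its smallest eigenvalue. $\|B\|_F$ is the Frobenius norm. *)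

theory Defs
  imports "Jordan_Normal_Form.Schur_Decomposition" "Jordan_Normal_Form.Char_Poly"
begin

definition hermitian_mat :: "complex mat \<Rightarrow> bool" where
  "hermitian_mat A \<longleftrightarrow> A \<in> carrier_mat (dim_row A) (dim_row A) \<and> mat_adjoint A = A"

definition eig_count_in :: "complex mat \<Rightarrow> real \<Rightarrow> real \<Rightarrow> nat" where
  "eig_count_in A a b =
     (\<Sum>x\<in>{x::real. a \<le> x \<and> x \<le> b \<and> eigenvalue A (complex_of_real x)}.
        order (complex_of_real x) (char_poly A))"

fun ctrl_gramian :: "complex mat \<Rightarrow> complex mat \<Rightarrow> nat \<Rightarrow> complex mat" where
  "ctrl_gramian A B 0 = B * mat_adjoint B"
| "ctrl_gramian A B (Suc t) = ctrl_gramian A B t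
      + (A ^\<^sub>m Suc t) * B * mat_adjoint B * (mat_adjoint A ^\<^sub>m Suc t)"

(* smallest eigenvalue of a Hermitian matrix (all its eigenvalues are real) *)
definition lambda_min :: "complex mat \<Rightarrow> real" where
  "lambda_min W = Min {x::real. eigenvalue W (complex_of_real x)}"

definition frob_norm :: "complex mat \<Rightarrow> real" where
  "frob_norm B = sqrt (\<Sum>i<dim_row B. \<Sum>j<dim_col B. (cmod (B $$ (i,j)))\<^sup>2)"

end

theory Submission
  imports Defs "HOL-Analysis.Convex"
begin

text \<open>
  Let \<open>r = \<lceil>m/k\<rceil> - 2\<close>, so that \<open>(r + 1) k < m\<close>. Write \<open>A = \<Sum>a. d\<^sub>a u\<^sub>a u\<^sub>a\<^sup>*\<close> and, for \<open>d\<^sub>a\<close> in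
  \<open>[-1, 1]\<close>, \<open>d\<^sub>a = cos \<theta>\<^sub>a\<close>. By counting dimensions there is a nonzero \<open>w = \<Sum>a. c\<^sub>a u\<^sub>a\<close>, supported on
  the eigenvalues in \<open>[-1, 1]\<close>, such that \<open>\<Sum>a. cos (j \<theta>\<^sub>a) c\<^sub>a (B\<^sup>* u\<^sub>a) = 0\<close> for all \<open>j \<le> r\<close>.
  Expanding \<open>d\<^sub>a^s = 2^-s \<Sum>i. (s choose i) cos ((2i - s) \<theta>\<^sub>a)\<close>, only the frequencies \<open>|2i - s| > r\<close>
  contribute to \<open>B\<^sup>* A^s w\<close>, and their total binomial weight is at most \<open>2 exp (- r\<^sup>2 / (2s))\<close> by Chernoff's
  bound. Hence each of the \<open>t\<close> terms with \<open>s > 0\<close> of \<open>w\<^sup>* W(t) w\<close> is at most \<open>4 exp (-q) \<parallel>B\<parallel>\<^sup>2 \<parallel>w\<parallel>\<^sup>2\<close>,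
  the term for \<open>s = 0\<close> vanishes, and the Rayleigh quotient at \<open>w\<close> bounds the smallest eigenvalue.
\<close>

subsection \<open>Powers of the cosine and binomial tails\<close>

text \<open>Termwise comparison of power series: since 2^n n! \<le> (2n)!, each term of the series
  of \<open>cosh x\<close> is at most the corresponding term of the series of
  \<open>exp (x\<^sup>2 / 2)\<close>. This is the sub-Gaussian bound for a random sign.\<close>

lemma cosh_le_exp_half_square: "cosh x \<le> exp (x\<^sup>2 / 2)" for x :: real
proof -
  have le: "2 ^ n * fact n \<le> (fact (2 * n) :: real)" for n
  proof (induction n)
    case (Suc n)
    have "2 ^ Suc n * fact (Suc n) = real (2 * n + 2) * (2 ^ n * fact n)"
      by (simp add: algebra_simps)
    also have "\<dots> \<le> (real (2 * n + 2) * real (2 * n + 1)) * fact (2 * n)"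
      using Suc by (intro mult_mono) (auto simp: algebra_simps)
    also have "\<dots> = fact (2 * Suc n)"
      by (simp add: algebra_simps)
    finally show ?case .
  qed simp
  have "(\<lambda>n. if even n then x ^ n /\<^sub>R fact n else 0) sums cosh x"
    by (rule cosh_converges)
  then have "(\<lambda>n. if even (2 * n) then x ^ (2 * n) /\<^sub>R fact (2 * n) else 0) sums cosh x"
    by (subst sums_mono_reindex[of "\<lambda>n. 2 * n"]) (auto simp: strict_mono_def)
  then have 1: "(\<lambda>n. x ^ (2 * n) / fact (2 * n)) sums cosh x"
    by (simp add: divide_inverse mult.commute)
  have 2: "(\<lambda>n. (x\<^sup>2 / 2) ^ n /\<^sub>R fact n) sums exp (x\<^sup>2 / 2)"
    by (rule exp_converges)
  show ?thesis
  proof (rule sums_le[OF _ 1 2])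
    fix n
    have "x ^ (2 * n) / fact (2 * n) \<le> x ^ (2 * n) / (2 ^ n * fact n)"
      by (rule divide_left_mono[OF le]) auto
    also have "\<dots> = (x\<^sup>2 / 2) ^ n /\<^sub>R fact n"
      unfolding power_mult[of x] power_divide by (simp add: divide_inverse)
    finally show "x ^ (2 * n) / fact (2 * n) \<le> (x\<^sup>2 / 2) ^ n /\<^sub>R fact n" .
  qed
qed

text \<open>Write 2 cos x as \<open>cis x + cis (- x)\<close>, apply the binomial theorem and take
  real parts. The frequencies \<open>2 * i - s\<close> are the positions of a simple random walk
  after \<open>s\<close> steps, and their weights are its probabilities.\<close>

lemma cos_power_eq_sum:
  "cos x ^ s = (\<Sum>i\<le>s. real (s choose i) * cos ((2 * real i - real s) * x)) / 2 ^ s"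
proof -
  have "(2 * complex_of_real (cos x)) ^ s = (cis x + cis (- x)) ^ s"
    by (rule arg_cong[where f = "\<lambda>z. z ^ s"]) (auto simp: complex_eq_iff)
  also have "\<dots> = (\<Sum>i\<le>s. of_nat (s choose i) * cis x ^ i * cis (- x) ^ (s - i))"
    by (rule binomial_ring)
  also have "\<dots> = (\<Sum>i\<le>s. of_nat (s choose i) * cis ((2 * real i - real s) * x))"
    by (rule sum.cong) (auto simp: DeMoivre cis_mult of_nat_diff algebra_simps)
  finally have "Re ((2 * complex_of_real (cos x)) ^ s)
      = Re (\<Sum>i\<le>s. of_nat (s choose i) * cis ((2 * real i - real s) * x))"
    by simp
  moreover have "(2 * complex_of_real (cos x)) ^ s = complex_of_real (2 ^ s * cos x ^ s)"
    by (simp add: power_mult_distrib)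
  ultimately have "2 ^ s * cos x ^ s
      = (\<Sum>i\<le>s. real (s choose i) * cos ((2 * real i - real s) * x))"
    by (simp del: of_real_mult of_real_power)
  then show ?thesis
    by (simp add: field_simps)
qed

text \<open>Two-sided Chernoff bound for a sum of \<open>s\<close> independent random signs, whose
  moment generating function is \<open>cosh z ^ s\<close>.\<close>

lemma binomial_tail_le:
  assumes "s > 0"
  shows "(\<Sum>i | i \<le> s \<and> real r < \<bar>2 * real i - real s\<bar>. real (s choose i)) / 2 ^ s
    \<le> 2 * exp (- (real r)\<^sup>2 / (2 * real s))"
proof -
  \<comment> \<open>This value minimises - y r + s y^2 / 2, the exponent that remains once
    \<open>cosh y ^ s\<close> is bounded by exp (s y^2 / 2).\<close>
  define y where "y = real r / real s"
  have y: "y \<ge> 0" by (simp add: y_def)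
  let ?S = "{i. i \<le> s \<and> real r < \<bar>2 * real i - real s\<bar>}"
  have mgf: "(\<Sum>i\<le>s. real (s choose i) * exp (z * (2 * real i - real s))) = 2 ^ s * cosh z ^ s" for z
  proof -
    have "(\<Sum>i\<le>s. real (s choose i) * exp (z * (2 * real i - real s)))
        = (\<Sum>i\<le>s. real (s choose i) * exp z ^ i * exp (- z) ^ (s - i))"
      by (rule sum.cong)
        (auto simp: exp_of_nat_mult[symmetric] exp_add[symmetric] of_nat_diff algebra_simps)
    also have "\<dots> = (exp z + exp (- z)) ^ s"
      by (rule binomial_ring[symmetric])
    also have "\<dots> = 2 ^ s * cosh z ^ s"
      by (simp add: cosh_field_def power_divide)
    finally show ?thesis .
  qed
  \<comment> \<open>On the tail at least one of the two exponentials, one for each sign, is at least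
    1. Their sum thus dominates the indicator of the tail, and the range can then be extended to all
    \<open>i \<le> s\<close>.\<close>
  have "(\<Sum>i\<in>?S. real (s choose i)) \<le> (\<Sum>i\<in>?S. real (s choose i) *
      (exp (y * (2 * real i - real s) - y * real r) + exp ((- y) * (2 * real i - real s) - y * real r)))"
  proof (rule sum_mono)
    fix i assume "i \<in> ?S"
    then have "0 \<le> y * ((2 * real i - real s) - real r) \<or> 0 \<le> y * (- (2 * real i - real s) - real r)"
      using y by (auto simp: abs_if split: if_splits)
    then have "0 \<le> y * (2 * real i - real s) - y * real r \<or> 0 \<le> (- y) * (2 * real i - real s) - y * real r"
      by (simp add: algebra_simps)
    then have "1 \<le> exp (y * (2 * real i - real s) - y * real r) \<or>
        1 \<le> exp ((- y) * (2 * real i - real s) - y * real r)"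
      by (simp only: one_le_exp_iff)
    then have "1 \<le> exp (y * (2 * real i - real s) - y * real r)
        + exp ((- y) * (2 * real i - real s) - y * real r)"
      by (smt (verit) exp_gt_zero)
    then show "real (s choose i) \<le> real (s choose i) * (exp (y * (2 * real i - real s) - y * real r)
        + exp ((- y) * (2 * real i - real s) - y * real r))"
      by (metis mult.right_neutral mult_left_mono of_nat_0_le_iff)
  qed
  also have "\<dots> \<le> (\<Sum>i\<le>s. real (s choose i) *
      (exp (y * (2 * real i - real s) - y * real r) + exp ((- y) * (2 * real i - real s) - y * real r)))"
    by (rule sum_mono2) auto
  also have "\<dots> = exp (- (y * real r)) * (2 ^ s * cosh y ^ s + 2 ^ s * cosh (- y) ^ s)"
    unfolding mgf[symmetric] sum.distrib[symmetric] sum_distrib_left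
    by (rule sum.cong) (auto simp: exp_diff exp_minus divide_inverse distrib_left mult_ac)
  also have "\<dots> = 2 ^ s * (2 * (exp (- (y * real r)) * cosh y ^ s))"
    by simp
  also have "\<dots> \<le> 2 ^ s * (2 * (exp (- (y * real r)) * exp (y\<^sup>2 / 2) ^ s))"
    by (intro mult_left_mono power_mono cosh_le_exp_half_square) auto
  also have "exp (- (y * real r)) * exp (y\<^sup>2 / 2) ^ s = exp (- (y * real r) + real s * (y\<^sup>2 / 2))"
    by (simp only: exp_of_nat_mult exp_add)
  also have "- (y * real r) + real s * (y\<^sup>2 / 2) = - (real r)\<^sup>2 / (2 * real s)"
    using assms by (simp add: y_def field_simps power2_eq_square)
  finally show ?thesis
    by (simp add: divide_le_eq mult.commute)
qed

text \<open>With d = cos \<theta>, the power d^s is a binomial average of cos ((2i - s) \<theta>).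
  The frequencies up to \<open>r\<close> are annihilated by the orthogonality assumption, the others
  have small total weight, and Cauchy-Schwarz bounds what each of them contributes.\<close>

lemma power_moment_bound:
  fixes d :: "'a \<Rightarrow> real" and g c :: "'a \<Rightarrow> complex"
  assumes d: "\<And>a. a \<in> I \<Longrightarrow> \<bar>d a\<bar> \<le> 1"
    and orth: "\<And>j. j \<le> r \<Longrightarrow> (\<Sum>a\<in>I. g a * of_real (cos (real j * arccos (d a))) * c a) = 0"
    and s: "s > 0"
  shows "(cmod (\<Sum>a\<in>I. of_real (d a ^ s) * g a * c a))\<^sup>2
    \<le> 4 * exp (- (real r)\<^sup>2 / real s) * ((\<Sum>a\<in>I. (cmod (g a))\<^sup>2) * (\<Sum>a\<in>I. (cmod (c a))\<^sup>2))"
proof -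
  define w where "w i = real (s choose i) / 2 ^ s" for i
  define K where "K i = (\<Sum>a\<in>I. g a * of_real (cos ((2 * real i - real s) * arccos (d a))) * c a)" for i
  define N where "N = (\<Sum>a\<in>I. cmod (g a) * cmod (c a))"
  let ?S = "{i. i \<le> s \<and> real r < \<bar>2 * real i - real s\<bar>}"
  have N0: "N \<ge> 0" unfolding N_def by (auto intro: sum_nonneg)
  have w0: "w i \<ge> 0" for i by (simp add: w_def)
  have pow: "d a ^ s = (\<Sum>i\<le>s. w i * cos ((2 * real i - real s) * arccos (d a)))" if "a \<in> I" for a
    using cos_power_eq_sum[of "arccos (d a)" s] d[OF that]
    by (simp add: w_def sum_divide_distrib cos_arccos_abs)
  have "(\<Sum>a\<in>I. of_real (d a ^ s) * g a * c a) = (\<Sum>i\<le>s. of_real (w i) * K i)"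
    unfolding K_def sum_distrib_left
    by (subst sum.swap, rule sum.cong)
      (auto simp: pow sum_distrib_left sum_distrib_right mult_ac simp del: of_real_power)
  also have "\<dots> = (\<Sum>i\<in>?S. of_real (w i) * K i)"
  proof (rule sum.mono_neutral_right)
    show "\<forall>i\<in>{..s} - ?S. of_real (w i) * K i = 0"
    proof
      fix i assume i: "i \<in> {..s} - ?S"
      \<comment> \<open>The orthogonality assumption speaks of natural frequencies; evenness of the
        cosine permits passing to the absolute value.\<close>
      define j where "j = nat \<bar>2 * int i - int s\<bar>"
      have j: "real j = \<bar>2 * real i - real s\<bar>" by (simp add: j_def)
      have "cos ((2 * real i - real s) * y) = cos (real j * y)" for y
        unfolding j by (auto simp: abs_if) (metis cos_minus minus_diff_eq mult_minus_left)
      moreover have "j \<le> r" using i j by auto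
      ultimately show "of_real (w i) * K i = 0"
        using orth[of j] by (simp add: K_def)
    qed
  qed auto
  finally have eq: "(\<Sum>a\<in>I. of_real (d a ^ s) * g a * c a) = (\<Sum>i\<in>?S. of_real (w i) * K i)" .
  have K: "cmod (K i) \<le> N" for i
    unfolding K_def N_def
    by (rule sum_norm_le) (auto simp: norm_mult intro!: mult_right_mono mult_left_le)
  have "cmod (\<Sum>i\<in>?S. of_real (w i) * K i) \<le> (\<Sum>i\<in>?S. w i * N)"
    by (rule sum_norm_le) (auto simp: norm_mult w0 intro!: mult_left_mono K)
  also have "\<dots> = (\<Sum>i\<in>?S. real (s choose i)) / 2 ^ s * N"
    by (simp add: w_def sum_distrib_right sum_divide_distrib)
  also have "\<dots> \<le> 2 * exp (- (real r)\<^sup>2 / (2 * real s)) * N"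
    by (rule mult_right_mono[OF binomial_tail_le[OF s] N0])
  finally have "(cmod (\<Sum>a\<in>I. of_real (d a ^ s) * g a * c a))\<^sup>2
      \<le> (2 * exp (- (real r)\<^sup>2 / (2 * real s)) * N)\<^sup>2"
    unfolding eq by (intro power_mono) auto
  also have "\<dots> = 4 * exp (- (real r)\<^sup>2 / real s) * N\<^sup>2"
    by (simp add: power_mult_distrib exp_double[symmetric])
  also have "\<dots> \<le> 4 * exp (- (real r)\<^sup>2 / real s) *
      ((\<Sum>a\<in>I. (cmod (g a))\<^sup>2) * (\<Sum>a\<in>I. (cmod (c a))\<^sup>2))"
    unfolding N_def by (intro mult_left_mono Cauchy_Schwarz_ineq_sum) auto
  finally show ?thesis .
qed

subsection \<open>Spectral decomposition of Hermitian matrices\<close>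

lemma mat_adjoint_index [simp]:
  fixes A :: "complex mat"
  assumes "i < dim_col A" "j < dim_row A"
  shows "mat_adjoint A $$ (i, j) = cnj (A $$ (j, i))"
  using assms by (simp add: mat_adjoint_def mat_of_rows_index conjugate_complex_def)

lemma mat_adjoint_dim [simp]:
  fixes A :: "complex mat"
  shows "dim_row (mat_adjoint A) = dim_col A" "dim_col (mat_adjoint A) = dim_row A"
  by (auto simp: mat_adjoint_def)

lemma hermitian_mat_index:
  assumes "hermitian_mat A" "A \<in> carrier_mat n n" "x < n" "y < n"
  shows "cnj (A $$ (x, y)) = A $$ (y, x)"
  using assms mat_adjoint_index[of y A x] by (auto simp: hermitian_mat_def)

lemma times_mat_index:
  assumes "A \<in> carrier_mat n m" "B \<in> carrier_mat m p" "i < n" "j < p"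
  shows "(A * B) $$ (i, j) = (\<Sum>l<m. A $$ (i, l) * B $$ (l, j))"
  using assms by (auto simp: scalar_prod_def atLeast0LessThan)

lemma mult_mat_vec_index:
  assumes "A \<in> carrier_mat n m" "v \<in> carrier_vec m" "i < n"
  shows "(A *\<^sub>v v) $ i = (\<Sum>l<m. A $$ (i, l) * v $ l)"
  using assms by (auto simp: scalar_prod_def atLeast0LessThan)

text \<open>Fewer homogeneous equations than unknowns: padding the system with zero rows gives a
  singular square matrix, and any nonzero kernel vector is a solution.\<close>

lemma exists_nonzero_solution:
  fixes F :: "'i \<Rightarrow> nat \<Rightarrow> complex"
  assumes "finite S" "card S < n"
  obtains c where "\<exists>a<n. c a \<noteq> 0" "\<And>i. i \<in> S \<Longrightarrow> (\<Sum>a<n. F i a * c a) = 0"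
proof -
  obtain h where h: "bij_betw h {0..<card S} S"
    using ex_bij_betw_nat_finite[OF assms(1)] by blast
  define M where "M = mat n n (\<lambda>(i, a). if i < card S then F (h i) a else 0)"
  have M: "M \<in> carrier_mat n n" by (simp add: M_def)
  let ?e = "unit_vec n (n - 1) :: complex vec"
  \<comment> \<open>The product is the last row of \<open>M\<close>, which is one of the padding
    rows because \<open>card S < n\<close>.\<close>
  have "M\<^sup>T *\<^sub>v ?e = 0\<^sub>v n"
  proof (rule eq_vecI)
    fix i assume "i < dim_vec (0\<^sub>v n :: complex vec)"
    then show "(M\<^sup>T *\<^sub>v ?e) $ i = 0\<^sub>v n $ i"
      using M assms(2) by (subst mult_mat_vec_index[of _ n n]) (auto simp: M_def)
  qed (use M in auto)
  moreover have "?e \<noteq> 0\<^sub>v n" "?e \<in> carrier_vec n"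
    using assms(2) by (auto simp: unit_vec_nonzero)
  ultimately have "det (M\<^sup>T) = 0"
    using det_0_iff_vec_prod_zero_field[of "M\<^sup>T" n] M transpose_carrier_mat by blast
  then have "det M = 0" using M by (simp add: det_transpose)
  then obtain v where v: "v \<in> carrier_vec n" "v \<noteq> 0\<^sub>v n" "M *\<^sub>v v = 0\<^sub>v n"
    using det_0_iff_vec_prod_zero_field[OF M] by auto
  show thesis
  proof
    show "\<exists>a<n. v $ a \<noteq> 0"
      using v(1,2) by (auto simp: vec_eq_iff)
    fix i assume "i \<in> S"
    then have "i \<in> h ` {0..<card S}" using h by (simp add: bij_betw_def)
    then obtain b where b: "b < card S" "i = h b" by auto
    have "(M *\<^sub>v v) $ b = 0" using v(3) b assms(2) by simp
    then show "(\<Sum>a<n. F i a * v $ a) = 0"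
      using b assms(2) by (subst (asm) mult_mat_vec_index[OF M v(1)]) (auto simp: M_def)
  qed
qed

text \<open>The trace is invariant under similarity, and the Schur form is triangular with the
  eigenvalues \<open>es\<close> on its diagonal.\<close>

lemma trace_eq_sum_eigenvalues:
  assumes M: "(M :: complex mat) \<in> carrier_mat n n"
    and es: "char_poly M = (\<Prod>e\<leftarrow>es. [:- e, 1:])"
  shows "(\<Sum>x<n. M $$ (x, x)) = sum_list es"
proof -
  obtain T P Q where s: "schur_decomposition M es = (T, P, Q)"
    by (cases "schur_decomposition M es") auto
  from schur_decomposition[OF M es s]
  have sim: "similar_mat_wit M T P Q" and diag: "diag_mat T = es" by auto
  note D = similar_mat_witD2[OF M sim]
  have TQ: "T * Q \<in> carrier_mat n n" using D by auto
  have "(\<Sum>x<n. M $$ (x, x)) = (\<Sum>x<n. (P * (T * Q)) $$ (x, x))"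
    using D by (simp add: assoc_mult_mat[of P n n T n Q n])
  also have "\<dots> = (\<Sum>x<n. \<Sum>y<n. P $$ (x, y) * (T * Q) $$ (y, x))"
    by (intro sum.cong refl times_mat_index[OF D(6) TQ]) auto
  also have "\<dots> = (\<Sum>y<n. \<Sum>x<n. (T * Q) $$ (y, x) * P $$ (x, y))"
    by (subst sum.swap) (simp add: mult.commute)
  also have "\<dots> = (\<Sum>y<n. ((T * Q) * P) $$ (y, y))"
    by (intro sum.cong refl times_mat_index[OF TQ D(6), symmetric]) auto
  also have "(T * Q) * P = T"
    using D by (simp add: assoc_mult_mat[of T n n Q n P n])
  also have "(\<Sum>y<n. T $$ (y, y)) = sum_list (diag_mat T)"
    using D(5) by (simp add: diag_mat_def sum_list_sum_nth atLeast0LessThan)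
  finally show ?thesis using diag by simp
qed

section \<open>Orthonormal eigenvectors of a Hermitian matrix\<close>

text \<open>Vectors are plain functions of the coordinate, read only below \<open>n\<close>, so that
  inner products are finite sums that can be reordered directly.\<close>

definition orthonormal_family :: "nat \<Rightarrow> nat \<Rightarrow> (nat \<Rightarrow> nat \<Rightarrow> complex) \<Rightarrow> bool" where
  "orthonormal_family n j u \<longleftrightarrow>
     (\<forall>a<j. \<forall>b<j. (\<Sum>x<n. cnj (u a x) * u b x) = (if a = b then 1 else 0))"

text \<open>Replacing each known real eigenvalue by \<open>\<i>\<close> leaves a matrix whose trace has imaginary
  part \<open>j < n\<close>, so some eigenvalue differs from \<open>\<i>\<close>; its eigenvectors are orthogonal to the known ones.\<close>

lemma hermitian_extend_eigenvectors:
  assumes A: "A \<in> carrier_mat n n" and herm: "hermitian_mat A"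
    and orth: "orthonormal_family n j u"
    and eig: "\<And>a x. a < j \<Longrightarrow> x < n \<Longrightarrow> (\<Sum>y<n. A $$ (x, y) * u a y) = of_real (d a) * u a x"
    and j: "j < n"
  shows "\<exists>(e :: real) v. (\<Sum>x<n. cnj (v x) * v x) = 1 \<and>
    (\<forall>a<j. (\<Sum>x<n. cnj (u a x) * v x) = 0) \<and>
    (\<forall>x<n. (\<Sum>y<n. A $$ (x, y) * v y) = of_real e * v x)"
proof -
  note Ac = hermitian_mat_index[OF herm A]
  have uu: "(\<Sum>x<n. cnj (u a x) * u b x) = (if a = b then 1 else 0)" if "a < j" "b < j" for a b
    using orth that by (auto simp: orthonormal_family_def)
  \<comment> \<open>\<open>M\<close> acts as \<open>\<i>\<close> on the span of the known
    eigenvectors and agrees with \<open>A\<close> on their orthogonal complement.\<close>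
  define M where "M = mat n n (\<lambda>(x, y). A $$ (x, y) + (\<Sum>a<j. (\<i> - of_real (d a)) * u a x * cnj (u a y)))"
  have M: "M \<in> carrier_mat n n" by (simp add: M_def)
  have eigl: "(\<Sum>x<n. cnj (u a x) * A $$ (x, y)) = of_real (d a) * cnj (u a y)" if "a < j" "y < n" for a y
  proof -
    have "(\<Sum>x<n. cnj (u a x) * A $$ (x, y)) = cnj (\<Sum>x<n. A $$ (y, x) * u a x)"
      using that by (auto simp: Ac mult.commute intro!: sum.cong)
    then show ?thesis using eig[OF that] by simp
  qed
  \<comment> \<open>The conjugates of the known vectors are left eigenvectors of \<open>M\<close>
    for \<open>\<i>\<close>; this is where the Hermitian property enters, through
    \<open>eigl\<close>.\<close>
  have Ml: "(\<Sum>x<n. cnj (u a x) * M $$ (x, y)) = \<i> * cnj (u a y)" if a: "a < j" and y: "y < n" for a y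
  proof -
    have "(\<Sum>x<n. cnj (u a x) * M $$ (x, y)) = (\<Sum>x<n. cnj (u a x) * A $$ (x, y))
        + (\<Sum>x<n. \<Sum>b<j. (\<i> - of_real (d b)) * cnj (u b y) * (cnj (u a x) * u b x))"
      using y by (simp add: M_def distrib_left sum.distrib sum_distrib_left mult_ac)
    also have "(\<Sum>x<n. \<Sum>b<j. (\<i> - of_real (d b)) * cnj (u b y) * (cnj (u a x) * u b x))
        = (\<Sum>b<j. (\<i> - of_real (d b)) * cnj (u b y) * (\<Sum>x<n. cnj (u a x) * u b x))"
      by (subst sum.swap) (simp add: sum_distrib_left)
    also have "\<dots> = (\<Sum>b<j. if b = a then (\<i> - of_real (d b)) * cnj (u b y) else 0)"
      using a by (intro sum.cong) (auto simp: uu)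
    also have "\<dots> = (\<i> - of_real (d a)) * cnj (u a y)"
      using a by simp
    finally show ?thesis using eigl[OF a y] by (simp add: algebra_simps)
  qed
  have trA: "Im (\<Sum>x<n. A $$ (x, x)) = 0"
  proof -
    have "Im (A $$ (x, x)) = 0" if "x < n" for x
      using Ac[OF that that] by (simp add: complex_eq_iff)
    then show ?thesis by simp
  qed
  have "(\<Sum>x<n. M $$ (x, x)) = (\<Sum>x<n. A $$ (x, x))
      + (\<Sum>x<n. \<Sum>b<j. (\<i> - of_real (d b)) * (cnj (u b x) * u b x))"
    by (simp add: M_def sum.distrib mult_ac)
  also have "(\<Sum>x<n. \<Sum>b<j. (\<i> - of_real (d b)) * (cnj (u b x) * u b x))
      = (\<Sum>b<j. (\<i> - of_real (d b)) * (\<Sum>x<n. cnj (u b x) * u b x))"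
    by (subst sum.swap) (simp add: sum_distrib_left)
  also have "\<dots> = (\<Sum>b<j. \<i> - of_real (d b))"
    by (intro sum.cong) (auto simp: uu)
  finally have trM: "Im (\<Sum>x<n. M $$ (x, x)) = real j"
    using trA by simp
  obtain es where es: "char_poly M = (\<Prod>e\<leftarrow>es. [:- e, 1:])" "length es = n"
    using char_poly_factorized[OF M] by blast
  have "\<exists>e\<in>set es. e \<noteq> \<i>"
  proof (rule ccontr)
    assume "\<not> ?thesis"
    then have "es = replicate n \<i>" using es(2) by (simp add: replicate_eqI)
    then have "Im (\<Sum>x<n. M $$ (x, x)) = real n"
      by (simp add: trace_eq_sum_eigenvalues[OF M es(1)] sum_list_replicate)
    with trM j show False by simp
  qed
  then obtain e where e: "e \<in> set es" "e \<noteq> \<i>" by blast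
  have "poly (char_poly M) e = 0"
    unfolding es(1) using e(1) by (induction es) auto
  then have "eigenvalue M e" by (simp add: eigenvalue_root_char_poly[OF M])
  then obtain z where z: "z \<in> carrier_vec n" "z \<noteq> 0\<^sub>v n" "M *\<^sub>v z = e \<cdot>\<^sub>v z"
    using M by (auto simp: eigenvalue_def eigenvector_def)
  have Mz: "(\<Sum>y<n. M $$ (x, y) * z $ y) = e * z $ x" if "x < n" for x
    using arg_cong[OF z(3), of "\<lambda>v. v $ x"] z(1) that by (simp add: mult_mat_vec_index[OF M z(1)])
  \<comment> \<open>Evaluating the product of the left eigenvector, \<open>M\<close> and
    \<open>z\<close> in two ways gives the factors \<open>e\<close> and \<open>\<i>\<close>, which
    differ.\<close>
  have uz: "(\<Sum>x<n. cnj (u a x) * z $ x) = 0" if a: "a < j" for a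
  proof -
    have "e * (\<Sum>x<n. cnj (u a x) * z $ x) = (\<Sum>x<n. cnj (u a x) * (\<Sum>y<n. M $$ (x, y) * z $ y))"
      unfolding sum_distrib_left[of e] by (intro sum.cong) (auto simp: Mz)
    also have "\<dots> = (\<Sum>y<n. (\<Sum>x<n. cnj (u a x) * M $$ (x, y)) * z $ y)"
      unfolding sum_distrib_left sum_distrib_right by (subst sum.swap) (simp add: mult_ac)
    also have "\<dots> = \<i> * (\<Sum>x<n. cnj (u a x) * z $ x)"
      unfolding sum_distrib_left[of \<i>] using a by (intro sum.cong) (auto simp: Ml)
    finally show ?thesis using e(2) by simp
  qed
  \<comment> \<open>Orthogonality kills the correction term in \<open>M\<close>, so \<open>z\<close>
    is an eigenvector of \<open>A\<close> itself.\<close>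
  have Az: "(\<Sum>y<n. A $$ (x, y) * z $ y) = e * z $ x" if x: "x < n" for x
  proof -
    have "e * z $ x = (\<Sum>y<n. A $$ (x, y) * z $ y)
        + (\<Sum>y<n. \<Sum>a<j. (\<i> - of_real (d a)) * u a x * (cnj (u a y) * z $ y))"
      unfolding Mz[OF x, symmetric] using x
      by (simp add: M_def distrib_right sum.distrib sum_distrib_right mult.assoc)
    also have "(\<Sum>y<n. \<Sum>a<j. (\<i> - of_real (d a)) * u a x * (cnj (u a y) * z $ y))
        = (\<Sum>a<j. (\<i> - of_real (d a)) * u a x * (\<Sum>y<n. cnj (u a y) * z $ y))"
      by (subst sum.swap) (simp add: sum_distrib_left)
    also have "\<dots> = 0" by (simp add: uz)
    finally show ?thesis by simp
  qed
  define N where "N = (\<Sum>x<n. (cmod (z $ x))\<^sup>2)"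
  have zz: "(\<Sum>x<n. cnj (z $ x) * z $ x) = of_real N"
    by (simp add: N_def complex_norm_square mult.commute del: of_real_power)
  have "\<exists>x<n. z $ x \<noteq> 0" using z(1,2) by (auto simp: vec_eq_iff)
  then have N: "N > 0"
    unfolding N_def by (auto intro!: sum_pos2)
  \<comment> \<open>The form z^* A z is computed with \<open>A\<close> acting on the right and on
    the left factor, which forces \<open>e\<close> to be real.\<close>
  have "e * of_real N = (\<Sum>x<n. cnj (z $ x) * (\<Sum>y<n. A $$ (x, y) * z $ y))"
    unfolding zz[symmetric] sum_distrib_left[of e] by (intro sum.cong) (auto simp: Az)
  also have "\<dots> = (\<Sum>y<n. cnj (\<Sum>x<n. A $$ (y, x) * z $ x) * z $ y)"
    unfolding cnj_sum sum_distrib_left sum_distrib_right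
    by (subst sum.swap) (auto simp: Ac mult_ac intro!: sum.cong)
  also have "\<dots> = cnj e * of_real N"
    unfolding zz[symmetric] sum_distrib_left[of "cnj e"]
    by (intro sum.cong) (auto simp: Az simp del: cnj_sum)
  finally have "e = cnj e" using N by simp
  then have er: "e = of_real (Re e)" by (simp add: complex_eq_iff)
  define v where "v x = z $ x / of_real (sqrt N)" for x
  have sq: "of_real (sqrt N) * of_real (sqrt N) = complex_of_real N"
    using N by (simp flip: of_real_mult)
  show ?thesis
  proof (intro exI conjI allI impI)
    have "(\<Sum>x<n. cnj (v x) * v x) = (\<Sum>x<n. cnj (z $ x) * z $ x) / of_real N"
      by (simp add: v_def sum_divide_distrib sq)
    then show "(\<Sum>x<n. cnj (v x) * v x) = 1" using N by (simp add: zz)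
    show "(\<Sum>x<n. cnj (u a x) * v x) = 0" if "a < j" for a
      using uz[OF that] by (simp add: v_def flip: sum_divide_distrib)
    show "(\<Sum>y<n. A $$ (x, y) * v y) = of_real (Re e) * v x" if "x < n" for x
      using Az[OF that] by (simp add: v_def er[symmetric] flip: sum_divide_distrib)
  qed
qed

text \<open>Eigenvectors are added one at a time; leaving \<open>j \<le> n\<close> free makes the
  induction possible, and \<open>j = n\<close> yields a full eigenbasis.\<close>

lemma hermitian_eigenvectors:
  assumes A: "A \<in> carrier_mat n n" and herm: "hermitian_mat A"
  shows "j \<le> n \<Longrightarrow> \<exists>u (d :: nat \<Rightarrow> real). orthonormal_family n j u \<and>
    (\<forall>a<j. \<forall>x<n. (\<Sum>y<n. A $$ (x, y) * u a y) = of_real (d a) * u a x)"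
proof (induction j)
  case 0
  then show ?case by (simp add: orthonormal_family_def)
next
  case (Suc j)
  then obtain u and d :: "nat \<Rightarrow> real" where u: "orthonormal_family n j u"
    and d: "\<And>a x. a < j \<Longrightarrow> x < n \<Longrightarrow> (\<Sum>y<n. A $$ (x, y) * u a y) = of_real (d a) * u a x"
    by auto
  obtain e :: real and v where v: "(\<Sum>x<n. cnj (v x) * v x) = 1"
    "\<And>a. a < j \<Longrightarrow> (\<Sum>x<n. cnj (u a x) * v x) = 0"
    "\<And>x. x < n \<Longrightarrow> (\<Sum>y<n. A $$ (x, y) * v y) = of_real e * v x"
    using hermitian_extend_eigenvectors[OF A herm u d] Suc.prems unfolding Suc_le_eq by blast
  have "(\<Sum>x<n. cnj (v x) * u a x) = 0" if "a < j" for a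
    using arg_cong[OF v(2)[OF that], of cnj] by (simp add: mult.commute)
  then have "orthonormal_family n (Suc j) (u(j := v))"
    using u v(1,2) by (auto simp: orthonormal_family_def less_Suc_eq)
  moreover have "\<forall>a<Suc j. \<forall>x<n. (\<Sum>y<n. A $$ (x, y) * (u(j := v)) a y)
      = of_real ((d(j := e)) a) * (u(j := v)) a x"
    using d v(3) by (auto simp: less_Suc_eq)
  ultimately show ?case by blast
qed

section \<open>Completeness, Parseval's identity and diagonalisation\<close>

lemma orthonormal_family_mat_inverse:
  assumes "orthonormal_family n n u"
  shows "mat n n (\<lambda>(a, x). cnj (u a x)) * mat n n (\<lambda>(x, a). u a x) = 1\<^sub>m n"
proof (rule eq_matI)
  fix a b assume "a < dim_row (1\<^sub>m n :: complex mat)" "b < dim_col (1\<^sub>m n :: complex mat)"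
  then show "(mat n n (\<lambda>(a, x). cnj (u a x)) * mat n n (\<lambda>(x, a). u a x)) $$ (a, b) = 1\<^sub>m n $$ (a, b)"
    using assms by (subst times_mat_index[of _ n n _ n]) (auto simp: orthonormal_family_def)
qed auto

text \<open>For square matrices a left inverse is also a right inverse, so orthonormality of the
  columns of \<open>U\<close> passes to its rows.\<close>

lemma orthonormal_family_complete:
  assumes "orthonormal_family n n u" "x < n" "y < n"
  shows "(\<Sum>a<n. u a x * cnj (u a y)) = (if x = y then 1 else 0)"
proof -
  define U where "U = mat n n (\<lambda>(x, a). u a x)"
  define V where "V = mat n n (\<lambda>(a, x). cnj (u a x))"
  have UV: "U \<in> carrier_mat n n" "V \<in> carrier_mat n n" by (auto simp: U_def V_def)
  have "U * V = 1\<^sub>m n"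
    using orthonormal_family_mat_inverse[OF assms(1)]
    by (intro mat_mult_left_right_inverse[OF UV(2,1)]) (simp add: U_def V_def)
  then show ?thesis
    using times_mat_index[OF UV assms(2,3)] assms(2,3) by (auto simp: U_def V_def)
qed

lemma orthonormal_family_Parseval:
  assumes "orthonormal_family n n u"
  shows "(\<Sum>a<n. (cmod (\<Sum>x<n. cnj (u a x) * f x))\<^sup>2) = (\<Sum>x<n. (cmod (f x))\<^sup>2)"
proof -
  have "complex_of_real (\<Sum>a<n. (cmod (\<Sum>x<n. cnj (u a x) * f x))\<^sup>2)
      = (\<Sum>a<n. \<Sum>y<n. \<Sum>x<n. f y * cnj (f x) * (u a x * cnj (u a y)))"
    by (simp add: complex_norm_square sum_product mult_ac del: of_real_power)
  also have "\<dots> = (\<Sum>y<n. \<Sum>a<n. \<Sum>x<n. f y * cnj (f x) * (u a x * cnj (u a y)))"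
    by (rule sum.swap)
  also have "\<dots> = (\<Sum>y<n. \<Sum>x<n. \<Sum>a<n. f y * cnj (f x) * (u a x * cnj (u a y)))"
    by (intro sum.cong refl sum.swap)
  also have "\<dots> = (\<Sum>y<n. \<Sum>x<n. if y = x then f y * cnj (f x) else 0)"
    by (intro sum.cong refl)
      (auto simp: orthonormal_family_complete[OF assms] simp flip: sum_distrib_left)
  also have "\<dots> = complex_of_real (\<Sum>x<n. (cmod (f x))\<^sup>2)"
    by (simp add: complex_norm_square del: of_real_power)
  finally show ?thesis by (simp only: of_real_eq_iff)
qed

text \<open>The entry formula follows from the eigenvector equations and completeness. The
  characteristic polynomial is included because it makes the \<open>d a\<close> list the eigenvalues
  with multiplicity.\<close>

lemma hermitian_spectral_decomposition:
  assumes A: "A \<in> carrier_mat n n" and herm: "hermitian_mat A"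
  shows "\<exists>u (d :: nat \<Rightarrow> real). orthonormal_family n n u \<and>
    (\<forall>x<n. \<forall>y<n. A $$ (x, y) = (\<Sum>a<n. of_real (d a) * u a x * cnj (u a y))) \<and>
    char_poly A = (\<Prod>a<n. [:- of_real (d a), 1:])"
proof -
  obtain u and d :: "nat \<Rightarrow> real" where u: "orthonormal_family n n u"
    and d: "\<And>a x. a < n \<Longrightarrow> x < n \<Longrightarrow> (\<Sum>y<n. A $$ (x, y) * u a y) = of_real (d a) * u a x"
    using hermitian_eigenvectors[OF A herm order.refl] by blast
  have dec: "A $$ (x, y) = (\<Sum>a<n. of_real (d a) * u a x * cnj (u a y))" if "x < n" "y < n" for x y
  proof -
    have "(\<Sum>a<n. of_real (d a) * u a x * cnj (u a y))
        = (\<Sum>a<n. (\<Sum>z<n. A $$ (x, z) * u a z) * cnj (u a y))"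
      using that by (simp add: d)
    also have "\<dots> = (\<Sum>z<n. A $$ (x, z) * (\<Sum>a<n. u a z * cnj (u a y)))"
      unfolding sum_distrib_left sum_distrib_right by (subst sum.swap) (simp add: mult_ac)
    also have "\<dots> = (\<Sum>z<n. if z = y then A $$ (x, z) else 0)"
      using that by (intro sum.cong) (auto simp: orthonormal_family_complete[OF u])
    finally show ?thesis using that by simp
  qed
  define U where "U = mat n n (\<lambda>(x, a). u a x)"
  define V where "V = mat n n (\<lambda>(a, x). cnj (u a x))"
  define E where "E = mat n n (\<lambda>(a, b). if a = b then complex_of_real (d a) else 0)"
  have UV: "U \<in> carrier_mat n n" "V \<in> carrier_mat n n" "E \<in> carrier_mat n n"
    by (auto simp: U_def V_def E_def)
  have VU: "V * U = 1\<^sub>m n"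
    using orthonormal_family_mat_inverse[OF u] by (simp add: U_def V_def)
  have "A = U * E * V"
  proof (rule eq_matI)
    fix x y assume "x < dim_row (U * E * V)" "y < dim_col (U * E * V)"
    then have xy: "x < n" "y < n" using UV by auto
    have UE: "(U * E) $$ (x, a) = of_real (d a) * u a x" if "a < n" for a
    proof -
      have "(U * E) $$ (x, a) = (\<Sum>b<n. if b = a then of_real (d a) * u a x else 0)"
        unfolding times_mat_index[OF UV(1,3) xy(1) that]
        using xy that by (intro sum.cong) (auto simp: U_def E_def)
      then show ?thesis using that by simp
    qed
    show "A $$ (x, y) = (U * E * V) $$ (x, y)"
      unfolding times_mat_index[OF mult_carrier_mat[OF UV(1,3)] UV(2) xy]
      using xy by (simp add: UE dec V_def del: index_mult_mat)
  qed (use UV A in auto)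
  \<comment> \<open>Similarity to the diagonal matrix \<open>E\<close> transfers its characteristic
    polynomial to \<open>A\<close>.\<close>
  then have "similar_mat A E"
    using UV A VU mat_mult_left_right_inverse[OF UV(2,1) VU] by (intro similar_matI[of _ _ U V n]) auto
  then have "char_poly A = char_poly E" by (rule char_poly_similar)
  also have "\<dots> = (\<Prod>a\<leftarrow>diag_mat E. [:- a, 1:])"
    by (rule char_poly_upper_triangular[OF UV(3)]) (auto simp: E_def upper_triangular_def)
  also have "\<dots> = (\<Prod>a<n. [:- of_real (d a), 1:])"
    by (auto simp: diag_mat_def E_def comp_def prod.list_conv_set_nth atLeast0LessThan intro!: prod.cong)
  finally show ?thesis using u dec by blast
qed

subsection \<open>The controllability Gramian\<close>

text \<open>The order of the root x in the product of linear factors is the number of indices with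
  \<open>d a = x\<close>; grouping the indices by value gives the count.\<close>

lemma eig_count_in_eq_card:
  assumes A: "A \<in> carrier_mat n n"
    and cp: "char_poly A = (\<Prod>a<n. [:- of_real (d a), 1:])"
  shows "eig_count_in A \<alpha> \<beta> = card {a. a < n \<and> \<alpha> \<le> d a \<and> d a \<le> \<beta>}"
proof -
  let ?I = "{a. a < n \<and> \<alpha> \<le> d a \<and> d a \<le> \<beta>}"
  have "eigenvalue A (complex_of_real x) \<longleftrightarrow> (\<exists>a<n. d a = x)" for x
    unfolding eigenvalue_root_char_poly[OF A] cp by (auto simp: poly_prod)
  then have S: "{x. \<alpha> \<le> x \<and> x \<le> \<beta> \<and> eigenvalue A (complex_of_real x)} = d ` ?I"
    by auto
  have ord: "order (complex_of_real x) (char_poly A) = card {a. a < n \<and> d a = x}" for x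
  proof -
    have "order (complex_of_real x) (char_poly A) = count (proots (char_poly A)) (complex_of_real x)"
      by (simp add: cp)
    also have "\<dots> = (\<Sum>a<n. if d a = x then 1 else 0)"
      unfolding cp by (subst proots_prod) (auto simp: count_sum intro!: sum.cong)
    also have "\<dots> = card {a. a < n \<and> d a = x}"
      by (simp add: sum.If_cases Int_def)
    finally show ?thesis .
  qed
  have "card ?I = (\<Sum>x\<in>d ` ?I. card {a \<in> ?I. d a = x})"
    using sum.image_gen[of ?I "\<lambda>_. 1 :: nat" d] by simp
  also have "\<dots> = (\<Sum>x\<in>d ` ?I. order (complex_of_real x) (char_poly A))"
    unfolding ord by (intro sum.cong arg_cong[where f = card]) auto
  finally show ?thesis
    unfolding eig_count_in_def S by simp
qed

lemma cnj_mult_self: "cnj z * z = of_real ((cmod z)\<^sup>2)"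
  by (metis complex_norm_square mult.commute)

text \<open>Rayleigh's principle: in eigencoordinates \<open>p a\<close> the form is the sum of d_a
  |p_a|^2, and every d_a is at least \<open>lambda_min W\<close>.\<close>

lemma lambda_min_le_quadratic_form:
  assumes W: "W \<in> carrier_mat n n" and herm: "hermitian_mat W"
  shows "lambda_min W * (\<Sum>x<n. (cmod (w x))\<^sup>2)
    \<le> Re (\<Sum>x<n. \<Sum>y<n. cnj (w x) * W $$ (x, y) * w y)"
proof -
  obtain u and d :: "nat \<Rightarrow> real" where u: "orthonormal_family n n u"
    and dec: "\<And>x y. x < n \<Longrightarrow> y < n \<Longrightarrow> W $$ (x, y) = (\<Sum>a<n. of_real (d a) * u a x * cnj (u a y))"
    and cp: "char_poly W = (\<Prod>a<n. [:- of_real (d a), 1:])"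
    using hermitian_spectral_decomposition[OF W herm] by blast
  define p where "p a = (\<Sum>x<n. cnj (u a x) * w x)" for a
  \<comment> \<open>The set in the definition of \<open>lambda_min\<close> is thereby finite, as
    needed for \<open>Min_le\<close>.\<close>
  have "{x. eigenvalue W (complex_of_real x)} = d ` {..<n}"
    unfolding eigenvalue_root_char_poly[OF W] cp by (auto simp: poly_prod)
  then have le: "lambda_min W \<le> d a" if "a < n" for a
    using that by (auto simp: lambda_min_def intro!: Min_le)
  have "lambda_min W * (\<Sum>x<n. (cmod (w x))\<^sup>2) = (\<Sum>a<n. lambda_min W * (cmod (p a))\<^sup>2)"
    unfolding sum_distrib_left[symmetric] p_def orthonormal_family_Parseval[OF u] ..
  also have "\<dots> \<le> (\<Sum>a<n. d a * (cmod (p a))\<^sup>2)"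
    by (intro sum_mono mult_right_mono le) auto
  also have "\<dots> = Re (\<Sum>a<n. of_real (d a) * (cnj (p a) * p a))"
    unfolding cnj_mult_self by (simp flip: of_real_mult of_real_sum del: of_real_power)
  also have "(\<Sum>a<n. of_real (d a) * (cnj (p a) * p a))
      = (\<Sum>a<n. \<Sum>x<n. \<Sum>y<n. cnj (w x) * (of_real (d a) * u a x * cnj (u a y)) * w y)"
    unfolding p_def cnj_sum sum_product unfolding sum_distrib_left by (simp add: mult_ac)
  also have "\<dots> = (\<Sum>x<n. \<Sum>a<n. \<Sum>y<n. cnj (w x) * (of_real (d a) * u a x * cnj (u a y)) * w y)"
    by (rule sum.swap)
  also have "\<dots> = (\<Sum>x<n. \<Sum>y<n. \<Sum>a<n. cnj (w x) * (of_real (d a) * u a x * cnj (u a y)) * w y)"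
    by (intro sum.cong refl sum.swap)
  also have "\<dots> = (\<Sum>x<n. \<Sum>y<n. cnj (w x) * W $$ (x, y) * w y)"
    by (intro sum.cong refl) (simp add: dec sum_distrib_left sum_distrib_right)
  finally show ?thesis .
qed

text \<open>Completeness handles the zeroth power; in each further multiplication by
  \<open>A\<close> orthonormality collapses the double sum to its diagonal.\<close>

lemma spectral_pow_mat:
  assumes A: "A \<in> carrier_mat n n" and u: "orthonormal_family n n u"
    and dec: "\<And>x y. x < n \<Longrightarrow> y < n \<Longrightarrow> A $$ (x, y) = (\<Sum>a<n. of_real (d a) * u a x * cnj (u a y))"
    and "x < n" "y < n"
  shows "(A ^\<^sub>m s) $$ (x, y) = (\<Sum>a<n. of_real (d a ^ s) * u a x * cnj (u a y))"
  using \<open>y < n\<close>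
proof (induction s arbitrary: y)
  case 0
  then show ?case
    using A \<open>x < n\<close> by (simp add: orthonormal_family_complete[OF u])
next
  case (Suc s)
  have P: "A ^\<^sub>m s \<in> carrier_mat n n" using A by simp
  have "(A ^\<^sub>m Suc s) $$ (x, y) = (\<Sum>z<n. (A ^\<^sub>m s) $$ (x, z) * A $$ (z, y))"
    using times_mat_index[OF P A \<open>x < n\<close> Suc.prems] by simp
  also have "\<dots> = (\<Sum>z<n. (\<Sum>a<n. of_real (d a ^ s) * u a x * cnj (u a z)) *
      (\<Sum>b<n. of_real (d b) * u b z * cnj (u b y)))"
    using Suc by (intro sum.cong) (auto simp: dec)
  also have "\<dots> = (\<Sum>z<n. \<Sum>a<n. \<Sum>b<n. of_real (d a ^ s * d b) * u a x * cnj (u b y) *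
      (cnj (u a z) * u b z))"
    unfolding cnj_sum sum_product by (simp add: mult_ac)
  also have "\<dots> = (\<Sum>a<n. \<Sum>z<n. \<Sum>b<n. of_real (d a ^ s * d b) * u a x * cnj (u b y) *
      (cnj (u a z) * u b z))"
    by (rule sum.swap)
  also have "\<dots> = (\<Sum>a<n. \<Sum>b<n. \<Sum>z<n. of_real (d a ^ s * d b) * u a x * cnj (u b y) *
      (cnj (u a z) * u b z))"
    by (intro sum.cong refl sum.swap)
  also have "\<dots> = (\<Sum>a<n. \<Sum>b<n. if b = a then of_real (d a ^ s * d b) * u a x * cnj (u b y) else 0)"
    using u by (intro sum.cong refl) (auto simp: orthonormal_family_def simp flip: sum_distrib_left)
  also have "\<dots> = (\<Sum>a<n. of_real (d a ^ Suc s) * u a x * cnj (u a y))"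
    by (intro sum.cong refl) (simp add: mult_ac)
  finally show ?case .
qed

lemma orthonormal_family_inner:
  assumes "orthonormal_family n n u"
  shows "(\<Sum>y<n. cnj (\<Sum>a<n. f a * u a y) * (\<Sum>b<n. g b * u b y)) = (\<Sum>a<n. cnj (f a) * g a)"
proof -
  have "(\<Sum>y<n. cnj (\<Sum>a<n. f a * u a y) * (\<Sum>b<n. g b * u b y))
      = (\<Sum>y<n. \<Sum>a<n. \<Sum>b<n. cnj (f a) * g b * (cnj (u a y) * u b y))"
    unfolding cnj_sum sum_product by (simp add: mult_ac)
  also have "\<dots> = (\<Sum>a<n. \<Sum>y<n. \<Sum>b<n. cnj (f a) * g b * (cnj (u a y) * u b y))"
    by (rule sum.swap)
  also have "\<dots> = (\<Sum>a<n. \<Sum>b<n. \<Sum>y<n. cnj (f a) * g b * (cnj (u a y) * u b y))"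
    by (intro sum.cong refl sum.swap)
  also have "\<dots> = (\<Sum>a<n. \<Sum>b<n. if b = a then cnj (f a) * g b else 0)"
    using assms by (intro sum.cong refl) (auto simp: orthonormal_family_def simp flip: sum_distrib_left)
  finally show ?thesis by simp
qed

lemma hermitian_pow_mat_index:
  assumes A: "A \<in> carrier_mat n n" and herm: "hermitian_mat A" and "x < n" "y < n"
  shows "cnj ((A ^\<^sub>m s) $$ (x, y)) = (A ^\<^sub>m s) $$ (y, x)"
proof -
  obtain u and d :: "nat \<Rightarrow> real" where u: "orthonormal_family n n u"
    and dec: "\<And>x y. x < n \<Longrightarrow> y < n \<Longrightarrow> A $$ (x, y) = (\<Sum>a<n. of_real (d a) * u a x * cnj (u a y))"
    using hermitian_spectral_decomposition[OF A herm] by blast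
  show ?thesis
    using assms(3,4) by (simp add: spectral_pow_mat[OF A u dec] mult_ac)
qed

section \<open>The Gramian as a sum of squares\<close>

lemma ctrl_gramian_carrier:
  assumes "A \<in> carrier_mat n n" "hermitian_mat A" "B \<in> carrier_mat n k"
  shows "ctrl_gramian A B t \<in> carrier_mat n n"
  using assms by (induction t) (auto simp: hermitian_mat_def)

text \<open>Powers of \<open>A\<close> are Hermitian, so the summand for \<open>s\<close> is F F^*
  with F = A^s B.\<close>

lemma ctrl_gramian_index:
  assumes A: "A \<in> carrier_mat n n" and herm: "hermitian_mat A" and B: "B \<in> carrier_mat n k"
    and x: "x < n" and y: "y < n"
  shows "ctrl_gramian A B t $$ (x, y)
    = (\<Sum>s\<le>t. \<Sum>l<k. (A ^\<^sub>m s * B) $$ (x, l) * cnj ((A ^\<^sub>m s * B) $$ (y, l)))"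
proof -
  have Ah: "mat_adjoint A = A" using herm by (simp add: hermitian_mat_def)
  have Bh: "mat_adjoint B \<in> carrier_mat k n" using B by auto
  have summand: "(A ^\<^sub>m s * B * mat_adjoint B * A ^\<^sub>m s) $$ (x, y)
      = (\<Sum>l<k. (A ^\<^sub>m s * B) $$ (x, l) * cnj ((A ^\<^sub>m s * B) $$ (y, l)))" for s
  proof -
    have P: "A ^\<^sub>m s \<in> carrier_mat n n" using A by simp
    have PB: "A ^\<^sub>m s * B \<in> carrier_mat n k" and BP: "mat_adjoint B * A ^\<^sub>m s \<in> carrier_mat k n"
      using P B Bh by auto
    have "(mat_adjoint B * A ^\<^sub>m s) $$ (l, y) = cnj ((A ^\<^sub>m s * B) $$ (y, l))" if "l < k" for l
      unfolding times_mat_index[OF Bh P that y] times_mat_index[OF P B y that] cnj_sum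
      using B that y by (intro sum.cong) (auto simp: hermitian_pow_mat_index[OF A herm] mult.commute)
    then show ?thesis
      unfolding assoc_mult_mat[OF PB Bh P] times_mat_index[OF PB BP x y] by simp
  qed
  show ?thesis
  proof (induction t)
    case 0
    have "A ^\<^sub>m 0 * B * mat_adjoint B * A ^\<^sub>m 0 = B * mat_adjoint B"
      using A B by simp
    then show ?case using summand[of 0] by simp
  next
    case (Suc t)
    have "dim_row (A ^\<^sub>m Suc t) = n" "dim_col (A ^\<^sub>m Suc t) = n" using A by auto
    then have "ctrl_gramian A B (Suc t) $$ (x, y) = ctrl_gramian A B t $$ (x, y)
        + (A ^\<^sub>m Suc t * B * mat_adjoint B * A ^\<^sub>m Suc t) $$ (x, y)"
      using x y by (simp add: Ah del: pow_mat.simps)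
    then show ?case unfolding summand Suc.IH by simp
  qed
qed

lemma ctrl_gramian_hermitian:
  assumes "A \<in> carrier_mat n n" "hermitian_mat A" "B \<in> carrier_mat n k"
  shows "hermitian_mat (ctrl_gramian A B t)"
proof -
  note W = ctrl_gramian_carrier[OF assms, of t]
  have "mat_adjoint (ctrl_gramian A B t) = ctrl_gramian A B t"
  proof (rule eq_matI)
    fix x y assume "x < dim_row (ctrl_gramian A B t)" "y < dim_col (ctrl_gramian A B t)"
    then show "mat_adjoint (ctrl_gramian A B t) $$ (x, y) = ctrl_gramian A B t $$ (x, y)"
      using W by (simp add: ctrl_gramian_index[OF assms] mult.commute del: index_mult_mat)
  qed (use W in auto)
  then show ?thesis using W by (simp add: hermitian_mat_def)
qed

text \<open>Each summand F F^* contributes the squared norm of F^* w; the steps only reorder finite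
  sums.\<close>

lemma ctrl_gramian_quadratic_form:
  assumes "A \<in> carrier_mat n n" "hermitian_mat A" "B \<in> carrier_mat n k"
  shows "Re (\<Sum>x<n. \<Sum>y<n. cnj (w x) * ctrl_gramian A B t $$ (x, y) * w y)
    = (\<Sum>s\<le>t. \<Sum>l<k. (cmod (\<Sum>y<n. cnj ((A ^\<^sub>m s * B) $$ (y, l)) * w y))\<^sup>2)"
proof -
  define F where "F s x l = (A ^\<^sub>m s * B) $$ (x, l)" for s x l
  have "(\<Sum>x<n. \<Sum>y<n. cnj (w x) * ctrl_gramian A B t $$ (x, y) * w y)
      = (\<Sum>x<n. \<Sum>y<n. \<Sum>s\<le>t. \<Sum>l<k. cnj (w x) * F s x l * (cnj (F s y l) * w y))"
    by (intro sum.cong refl)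
      (simp add: ctrl_gramian_index[OF assms] F_def sum_distrib_left sum_distrib_right mult_ac
        del: index_mult_mat)
  also have "\<dots> = (\<Sum>x<n. \<Sum>s\<le>t. \<Sum>y<n. \<Sum>l<k. cnj (w x) * F s x l * (cnj (F s y l) * w y))"
    by (intro sum.cong refl sum.swap)
  also have "\<dots> = (\<Sum>s\<le>t. \<Sum>x<n. \<Sum>y<n. \<Sum>l<k. cnj (w x) * F s x l * (cnj (F s y l) * w y))"
    by (rule sum.swap)
  also have "\<dots> = (\<Sum>s\<le>t. \<Sum>x<n. \<Sum>l<k. \<Sum>y<n. cnj (w x) * F s x l * (cnj (F s y l) * w y))"
    by (intro sum.cong refl sum.swap)
  also have "\<dots> = (\<Sum>s\<le>t. \<Sum>l<k. \<Sum>x<n. \<Sum>y<n. cnj (w x) * F s x l * (cnj (F s y l) * w y))"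
    by (intro sum.cong refl sum.swap)
  also have "\<dots> = (\<Sum>s\<le>t. \<Sum>l<k. cnj (\<Sum>y<n. cnj (F s y l) * w y) * (\<Sum>y<n. cnj (F s y l) * w y))"
    unfolding cnj_sum sum_product by (simp add: mult_ac)
  also have "Re \<dots> = (\<Sum>s\<le>t. \<Sum>l<k. (cmod (\<Sum>y<n. cnj (F s y l) * w y))\<^sup>2)"
    unfolding Re_sum cnj_mult_self Re_complex_of_real ..
  finally show ?thesis by (simp only: F_def)
qed

section \<open>The bound on the smallest eigenvalue of the Gramian\<close>

text \<open>The hypothesis on \<open>r\<close> says that r + 1 moment conditions for each of the
  \<open>k\<close> columns of \<open>B\<close> are fewer than the eigenvalues in [-1, 1], which
  leaves room for a nonzero test vector.\<close>

lemma lambda_min_ctrl_gramian_le: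
  assumes A: "A \<in> carrier_mat n n" and herm: "hermitian_mat A" and B: "B \<in> carrier_mat n k"
    and count: "(r + 1) * k < eig_count_in A (-1) 1"
    and q: "q > 0" and t: "real t \<le> (real r)\<^sup>2 / q"
  shows "lambda_min (ctrl_gramian A B t) \<le> 4 * ((real r)\<^sup>2 / q) * exp (- q) * (frob_norm B)\<^sup>2"
proof -
  obtain u and d :: "nat \<Rightarrow> real" where u: "orthonormal_family n n u"
    and dec: "\<And>x y. x < n \<Longrightarrow> y < n \<Longrightarrow> A $$ (x, y) = (\<Sum>a<n. of_real (d a) * u a x * cnj (u a y))"
    and cp: "char_poly A = (\<Prod>a<n. [:- of_real (d a), 1:])"
    using hermitian_spectral_decomposition[OF A herm] by blast
  define I where "I = {a. a < n \<and> - 1 \<le> d a \<and> d a \<le> 1}"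
  have I: "I \<subseteq> {..<n}" and finI: "finite I" by (auto simp: I_def)
  have cardI: "(r + 1) * k < card I"
    using count unfolding eig_count_in_eq_card[OF A cp] I_def by simp
  \<comment> \<open>Coordinates of the columns of \<open>B\<close> in the eigenbasis.\<close>
  define G where "G a l = (\<Sum>y<n. cnj (u a y) * B $$ (y, l))" for a l
  \<comment> \<open>The equations \<open>Inl b\<close> remove the eigenvalues outside [-1, 1], where
    \<open>arccos\<close> has no meaning. The equations \<open>Inr (j, l)\<close> are the moment
    conditions; on [-1, 1] the weight cos (j arccos x) is the Chebyshev polynomial T_j.\<close>
  define F where "F = (\<lambda>i. case i of Inl b \<Rightarrow> (\<lambda>a. if a = b then 1 else 0)
    | Inr (j, l) \<Rightarrow> (\<lambda>a. cnj (G a l) * of_real (cos (real j * arccos (d a)))))"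
  define S where "S = ({..<n} - I) <+> ({..r} \<times> {..<k})"
  have "card S = (n - card I) + (r + 1) * k"
    using I finI by (simp add: S_def card_Plus card_Diff_subset)
  moreover have "card I \<le> n" using card_mono[OF _ I] by simp
  ultimately have "card S < n" using cardI by linarith
  then obtain c where c0: "\<exists>a<n. c a \<noteq> 0"
    and c: "\<And>i. i \<in> S \<Longrightarrow> (\<Sum>a<n. F i a * c a) = 0"
    using exists_nonzero_solution[of S n F] by (auto simp: S_def)
  have cI: "c a = 0" if "a < n" "a \<notin> I" for a
  proof -
    have "(\<Sum>b<n. F (Inl a) b * c b) = (\<Sum>b<n. if b = a then c b else 0)"
      by (intro sum.cong) (auto simp: F_def)
    then show ?thesis using c[of "Inl a"] that by (auto simp: S_def)
  qed
  have toI: "(\<Sum>a<n. h a * c a) = (\<Sum>a\<in>I. h a * c a)" for h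
    using I cI by (intro sum.mono_neutral_right) auto
  have orth: "(\<Sum>a\<in>I. cnj (G a l) * of_real (cos (real j * arccos (d a))) * c a) = 0"
    if "j \<le> r" "l < k" for j l
    unfolding toI[symmetric] using c[of "Inr (j, l)"] that by (auto simp: F_def S_def)
  define w where "w x = (\<Sum>a<n. c a * u a x)" for x
  \<comment> \<open>\<open>C\<close> will be the squared norm of the coefficients and, by
    orthonormality, also of the test vector \<open>w\<close>.\<close>
  define C where "C = (\<Sum>a<n. (cmod (c a))\<^sup>2)"
  have C: "C > 0" using c0 unfolding C_def by (auto intro!: sum_pos2)
  have CI: "(\<Sum>a\<in>I. (cmod (c a))\<^sup>2) = C"
    unfolding C_def using I cI by (intro sum.mono_neutral_left) auto
  have "complex_of_real (\<Sum>x<n. (cmod (w x))\<^sup>2) = of_real C"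
    using orthonormal_family_inner[OF u, of c c]
    by (simp add: w_def C_def complex_norm_square mult.commute del: of_real_power)
  then have wC: "(\<Sum>x<n. (cmod (w x))\<^sup>2) = C" by (simp only: of_real_eq_iff)
  have AB: "(A ^\<^sub>m s * B) $$ (y, l) = (\<Sum>a<n. (of_real (d a ^ s) * G a l) * u a y)"
    if "y < n" "l < k" for s y l
  proof -
    have "(A ^\<^sub>m s * B) $$ (y, l)
        = (\<Sum>z<n. (\<Sum>a<n. of_real (d a ^ s) * u a y * cnj (u a z)) * B $$ (z, l))"
      using A that by (subst times_mat_index[OF _ B]) (auto simp: spectral_pow_mat[OF A u dec])
    also have "\<dots> = (\<Sum>a<n. (of_real (d a ^ s) * G a l) * u a y)"
      unfolding G_def sum_distrib_left sum_distrib_right by (subst sum.swap) (simp add: mult_ac)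
    finally show ?thesis .
  qed
  \<comment> \<open>This is B^* A^s w in eigencoordinates, in the form that
    \<open>power_moment_bound\<close> treats.\<close>
  have resp: "(\<Sum>y<n. cnj ((A ^\<^sub>m s * B) $$ (y, l)) * w y)
      = (\<Sum>a\<in>I. of_real (d a ^ s) * cnj (G a l) * c a)" if "l < k" for s l
  proof -
    have "(\<Sum>y<n. cnj ((A ^\<^sub>m s * B) $$ (y, l)) * w y)
        = (\<Sum>y<n. cnj (\<Sum>a<n. (of_real (d a ^ s) * G a l) * u a y) * (\<Sum>b<n. c b * u b y))"
      using that by (intro sum.cong) (auto simp: AB w_def simp del: index_mult_mat)
    also have "\<dots> = (\<Sum>a<n. cnj (of_real (d a ^ s) * G a l) * c a)"
      by (rule orthonormal_family_inner[OF u])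
    finally show ?thesis unfolding toI by simp
  qed
  \<comment> \<open>Parseval for each column of \<open>B\<close>; restricting to \<open>I\<close>
    only decreases the sum.\<close>
  have "(\<Sum>l<k. \<Sum>a\<in>I. (cmod (G a l))\<^sup>2) \<le> (\<Sum>l<k. \<Sum>a<n. (cmod (G a l))\<^sup>2)"
    using I by (intro sum_mono sum_mono2) auto
  also have "\<dots> = (\<Sum>l<k. \<Sum>y<n. (cmod (B $$ (y, l)))\<^sup>2)"
    unfolding G_def orthonormal_family_Parseval[OF u] ..
  also have "\<dots> = (frob_norm B)\<^sup>2"
    using B unfolding frob_norm_def by (subst sum.swap) (simp add: sum_nonneg)
  finally have G: "(\<Sum>l<k. \<Sum>a\<in>I. (cmod (G a l))\<^sup>2) \<le> (frob_norm B)\<^sup>2" .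
  define b where "b s = (\<Sum>l<k. (cmod (\<Sum>y<n. cnj ((A ^\<^sub>m s * B) $$ (y, l)) * w y))\<^sup>2)" for s
  \<comment> \<open>The moment condition for \<open>j = 0\<close> says B^* w = 0. Hence only
    \<open>t\<close> of the t + 1 terms count, and the final factor is r^2 / q without an extra
    1.\<close>
  have b0: "b 0 = 0"
    using orth[of 0] by (auto simp: b_def resp simp del: pow_mat.simps intro!: sum.neutral)
  have b: "b s \<le> 4 * exp (- q) * (frob_norm B)\<^sup>2 * C" if "s \<in> {1..t}" for s
  proof -
    \<comment> \<open>The time bound enters here: s \<le> t \<le> r^2 / q makes the exponent r^2 / s
      at least \<open>q\<close>.\<close>
    have "real s * q \<le> real t * q" using that q by simp
    also have "\<dots> \<le> (real r)\<^sup>2" using t q by (simp add: pos_le_divide_eq)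
    finally have e: "- (real r)\<^sup>2 / real s \<le> - q"
      using that by (simp add: field_simps)
    have "b s \<le> (\<Sum>l<k. 4 * exp (- (real r)\<^sup>2 / real s) * ((\<Sum>a\<in>I. (cmod (cnj (G a l)))\<^sup>2) * C))"
      unfolding b_def
    proof (rule sum_mono)
      fix l assume "l \<in> {..<k}"
      then have l: "l < k" by simp
      show "(cmod (\<Sum>y<n. cnj ((A ^\<^sub>m s * B) $$ (y, l)) * w y))\<^sup>2
          \<le> 4 * exp (- (real r)\<^sup>2 / real s) * ((\<Sum>a\<in>I. (cmod (cnj (G a l)))\<^sup>2) * C)"
        unfolding resp[OF l] CI[symmetric]
        by (rule power_moment_bound) (use that l orth in \<open>auto simp: I_def\<close>)
    qed
    also have "\<dots> = 4 * exp (- (real r)\<^sup>2 / real s) * ((\<Sum>l<k. \<Sum>a\<in>I. (cmod (G a l))\<^sup>2) * C)"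
      by (simp add: sum_distrib_left sum_distrib_right mult_ac)
    also have "\<dots> \<le> 4 * exp (- q) * ((frob_norm B)\<^sup>2 * C)"
      using e G C by (intro mult_mono) (auto intro!: sum_nonneg mult_nonneg_nonneg)
    finally show ?thesis by (simp add: mult_ac)
  qed
  have "lambda_min (ctrl_gramian A B t) * C \<le> (\<Sum>s\<le>t. b s)"
    unfolding wC[symmetric] b_def ctrl_gramian_quadratic_form[OF A herm B, symmetric]
    by (rule lambda_min_le_quadratic_form[OF ctrl_gramian_carrier[OF A herm B]
          ctrl_gramian_hermitian[OF A herm B]])
  also have "\<dots> = (\<Sum>s\<in>{1..t}. b s)"
    using b0 by (intro sum.mono_neutral_right) (auto simp: Suc_le_eq)
  also have "\<dots> \<le> real t * (4 * exp (- q) * (frob_norm B)\<^sup>2 * C)"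
    using sum_bounded_above[of "{1..t}" b, OF b] by simp
  also have "\<dots> \<le> ((real r)\<^sup>2 / q) * (4 * exp (- q) * (frob_norm B)\<^sup>2 * C)"
    using C by (intro mult_right_mono t) auto
  finally have "lambda_min (ctrl_gramian A B t) * C
      \<le> (4 * ((real r)\<^sup>2 / q) * exp (- q) * (frob_norm B)\<^sup>2) * C"
    by (simp add: mult_ac)
  then show ?thesis using C by (rule mult_right_le_imp_le)
qed

theorem theorem2:
  fixes A B :: "complex mat" and n k m t :: nat and q :: real
  assumes "A \<in> carrier_mat n n"
    and "hermitian_mat A"
    and "eig_count_in A (-1) 1 \<ge> m"
    and "B \<in> carrier_mat n k"
    and "m > 2 * k"
    and "q > 0"
    and "real t \<le> (real_of_int (\<lceil>real m / real k\<rceil>) - 2)\<^sup>2 / q"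
  shows "lambda_min (ctrl_gramian A B t)
           \<le> 4 * ((real_of_int (\<lceil>real m / real k\<rceil>) - 2)\<^sup>2 / q) * exp (- q) * (frob_norm B)\<^sup>2"
proof -
  \<comment> \<open>The absolute value only matters for \<open>k = 0\<close>, where \<open>m / k = 0\<close>.\<close>
  define r where "r = nat \<bar>\<lceil>real m / real k\<rceil> - 2\<bar>"
  have r: "real r = \<bar>real_of_int \<lceil>real m / real k\<rceil> - 2\<bar>"
    by (simp add: r_def)
  have "(r + 1) * k < m"
  proof (cases "k = 0")
    case True
    then show ?thesis using assms(5) by simp
  next
    case False
    then have "2 < real m / real k"
      using assms(5) by (simp add: pos_less_divide_eq flip: of_nat_mult)
    \<comment> \<open>Since m / k > 2 the absolute value disappears, so r + 1 is the ceiling of m /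
      k minus 1, which is below m / k.\<close>
    then have "real r + 1 < real m / real k"
      unfolding r by linarith
    then have "real ((r + 1) * k) < real m"
      using False by (simp add: pos_less_divide_eq algebra_simps)
    then show ?thesis by linarith
  qed
  then show ?thesis
    using lambda_min_ctrl_gramian_le[OF assms(1,2,4) _ assms(6), of r t] assms(3,7)
    by (simp add: r)
qed

end
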